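(* Let $r$ be a constant positive integer and let $s = s(n)$ be a positive-integer-valued function of $n$. If $P_s$ (for each value $s = s(n)$) is any 0-1 matrix with $s$ columns and at most $r$ rows, and $P_s$ has ones in both the first and last columns, then $ex(n, P_{s}) = \Omega(n^{2-o(1)})$ if and only if $s(n) = \Omega(n^{1-o(1)})$.
   Context: A 0-1 matrix $A$ contains a 0-1 matrix $P$ if $A$ has a submatrix (obtained by deleting rows and columns, keeping the order of the remaining ones) that is equal to $P$ or that can be turned into $P$ by changing some ones to zeroes; otherwise $A$ avoids $P$. $ex(n, P)$ denotes the maximum number of ones in an $n \times n$ 0-1 matrix that avoids $P$. "Has ones in both the first and last columns" means that the first column contains at least one $1$ and the last column contains at least one $1$. Asymptotics are as $n \to \infty$; $f(n) = \Omega(n^{k-o(1)})$ means that for every $\varepsilon > 0$ one has $f(n) \geq n^{k-\varepsilon}$ for all sufficiently large $n$. *)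

theory Defs
  imports Complex_Main "Jordan_Normal_Form.DL_Submatrix"
begin

definition zero_one_mat :: "nat mat \<Rightarrow> bool" where
  "zero_one_mat A \<longleftrightarrow> elements_mat A \<subseteq> {0, 1}"

definition contains_mat :: "nat mat \<Rightarrow> nat mat \<Rightarrow> bool" where
  "contains_mat A P \<longleftrightarrow>
     (\<exists>I J. dim_row (submatrix A I J) = dim_row P \<and>
            dim_col (submatrix A I J) = dim_col P \<and>
            (\<forall>i < dim_row P. \<forall>j < dim_col P.
               submatrix A I J $$ (i, j) = P $$ (i, j) \<or>
               (submatrix A I J $$ (i, j) = 1 \<and> P $$ (i, j) = 0)))"

abbreviation avoids_mat :: "nat mat \<Rightarrow> nat mat \<Rightarrow> bool" where
  "avoids_mat A P \<equiv> \<not> contains_mat A P"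

definition num_ones :: "nat mat \<Rightarrow> nat" where
  "num_ones A = card {(i, j). i < dim_row A \<and> j < dim_col A \<and> A $$ (i, j) = 1}"

(* The set below is always finite. It is nonempty whenever P has an entry 1, since the
   zero matrix then avoids P; for an all-zero P it may be empty, and ex n P is then
   unspecified. *)
definition ex :: "nat \<Rightarrow> nat mat \<Rightarrow> nat" where
  "ex n P = Max {num_ones A | A. A \<in> carrier_mat n n \<and> zero_one_mat A \<and> avoids_mat A P}"

definition ones_in_first_and_last_column :: "nat mat \<Rightarrow> bool" where
  "ones_in_first_and_last_column P \<longleftrightarrow>
     (\<exists>i < dim_row P. P $$ (i, 0) = 1) \<and> (\<exists>i < dim_row P. P $$ (i, dim_col P - 1) = 1)"

(* f(n) = Omega(n^(k - o(1))) as n tends to infinity *)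
definition Omega_pow_minus_o1 :: "real \<Rightarrow> (nat \<Rightarrow> nat) \<Rightarrow> bool" where
  "Omega_pow_minus_o1 k f \<longleftrightarrow>
     (\<forall>\<epsilon>::real. \<epsilon> > 0 \<longrightarrow> (\<forall>\<^sub>F n in sequentially. real (f n) \<ge> real n powr (k - \<epsilon>)))"

end

theory Submission
  imports Defs "HOL-Real_Asymp.Real_Asymp"
begin

text \<open>
  Both directions rest on an estimate of \<open>ex n P\<close> for a 0-1 matrix \<open>P\<close> with \<open>s\<close> columns and at
  most \<open>r\<close> rows.

  If \<open>s\<close> is large, so is \<open>ex n P\<close>: the matrix whose ones fill precisely its first \<open>s - 1\<close> columns
  avoids \<open>P\<close>, because in any copy of \<open>P\<close> the last of the \<open>s\<close> columns lies to the right of these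
  and \<open>P\<close> needs a one there. So \<open>ex n P\<close> is at least \<open>n * min n (s - 1)\<close>
  (\<open>ex_ge_filled_columns\<close>).

  If \<open>s\<close> is small, so is \<open>ex n P\<close>, by the argument of Kovari, Sos and Turan. A matrix with at least
  \<open>2 * (n * k)\<close> ones has at least \<open>k\<close> columns with at least \<open>k\<close> ones each
  (\<open>many_columns_with_many_ones\<close>), and each of them has all ones on at least \<open>k choose r\<close> sets of
  \<open>r\<close> rows. Were \<open>k * (k choose r)\<close> more than \<open>s * (n choose r)\<close>, then some set of \<open>r\<close> rows
  would be shared by \<open>s\<close> columns (\<open>popular_subset\<close>), and this all-ones block contains \<open>P\<close>,
  whatever its entries are. With \<open>k\<close> about \<open>n powr (1 - \<epsilon>) / 2\<close> the resulting bound
  (\<open>ex_ge_imp_width_ge\<close>) turns \<open>ex n P \<ge> n powr (2 - \<epsilon>)\<close> into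
  \<open>s \<ge> c * n powr (1 - (r + 1) * \<epsilon>)\<close> for large \<open>n\<close>, with \<open>c\<close> depending on \<open>r\<close> only. Since \<open>r\<close> is constant
  and \<open>\<epsilon>\<close> arbitrary, the loss disappears in the exponent.
\<close>

section \<open>Counting ones in 0-1 matrices\<close>

lemma zero_one_mat_entry:
  assumes "zero_one_mat A" "i < dim_row A" "j < dim_col A"
  shows "A $$ (i, j) = 0 \<or> A $$ (i, j) = 1"
  using assms elements_matI[of A "dim_row A" "dim_col A"] unfolding zero_one_mat_def by auto

lemma num_ones_le:
  assumes "A \<in> carrier_mat m n"
  shows "num_ones A \<le> m * n"
proof -
  have "num_ones A \<le> card ({..<m} \<times> {..<n})"
    unfolding num_ones_def using assms by (intro card_mono) auto
  then show ?thesis by simp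
qed

lemma num_ones_by_columns:
  "num_ones A = (\<Sum>j<dim_col A. card {i. i < dim_row A \<and> A $$ (i, j) = 1})"
proof -
  let ?C = "\<lambda>j. {i. i < dim_row A \<and> A $$ (i, j) = 1}"
  have "bij_betw prod.swap {(i, j). i < dim_row A \<and> j < dim_col A \<and> A $$ (i, j) = 1}
          (Sigma {..<dim_col A} ?C)"
    by (rule bij_betwI[where g = prod.swap]) auto
  then have "num_ones A = card (Sigma {..<dim_col A} ?C)"
    unfolding num_ones_def by (rule bij_betw_same_card)
  then show ?thesis by simp
qed

lemma finite_ex_candidates:
  "finite {num_ones A | A. A \<in> carrier_mat n n \<and> zero_one_mat A \<and> avoids_mat A P}"
proof (rule finite_subset)
  show "{num_ones A | A. A \<in> carrier_mat n n \<and> zero_one_mat A \<and> avoids_mat A P} \<subseteq> {..n * n}"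
    using num_ones_le by blast
qed simp

section \<open>A lower bound from filled columns\<close>

definition filled_columns :: "nat \<Rightarrow> nat \<Rightarrow> nat mat" where
  "filled_columns n q = mat n n (\<lambda>(i, j). if j < q then 1 else 0)"

lemma zero_one_mat_filled_columns: "zero_one_mat (filled_columns n q)"
proof -
  have "a = 0 \<or> a = 1" if "a \<in> elements_mat (filled_columns n q)" for a
    using elements_matD[OF that] by (elim exE) (simp add: filled_columns_def)
  then show ?thesis unfolding zero_one_mat_def by blast
qed

lemma num_ones_filled_columns: "num_ones (filled_columns n q) = n * min n q"
proof -
  have "{(i, j). i < n \<and> j < n \<and> filled_columns n q $$ (i, j) = 1} = {..<n} \<times> {..<min n q}"
    by (auto simp: filled_columns_def split: if_splits)
  then show ?thesis
    unfolding num_ones_def by (simp add: card_cartesian_product filled_columns_def)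
qed

text \<open>
  The last chosen column has \<open>dim_col P - 1\<close> chosen columns to its left, so it lies beyond the
  filled part and cannot supply the one in the last column of \<open>P\<close>.
\<close>

lemma filled_columns_avoid:
  assumes one: "i < dim_row P" "P $$ (i, dim_col P - 1) = 1" and "dim_col P \<ge> 1"
  shows "avoids_mat (filled_columns n (dim_col P - 1)) P" (is "avoids_mat ?A P")
proof
  assume "contains_mat ?A P"
  then obtain I J where rows: "dim_row (submatrix ?A I J) = dim_row P"
    and cols: "dim_col (submatrix ?A I J) = dim_col P"
    and entries: "\<And>i j. i < dim_row P \<Longrightarrow> j < dim_col P \<Longrightarrow>
       submatrix ?A I J $$ (i, j) = P $$ (i, j) \<or>
       (submatrix ?A I J $$ (i, j) = 1 \<and> P $$ (i, j) = 0)"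
    unfolding contains_mat_def by blast
  let ?q = "dim_col P - 1"
  have q: "?q < dim_col P" using \<open>dim_col P \<ge> 1\<close> by simp
  have i: "i < card {i. i < dim_row ?A \<and> i \<in> I}"
    using rows one(1) by (simp add: dim_submatrix)
  have j: "?q < card {j. j < dim_col ?A \<and> j \<in> J}"
    using cols q by (simp add: dim_submatrix)
  have "submatrix ?A I J $$ (i, ?q) = ?A $$ (pick I i, pick J ?q)"
    using submatrix_index[OF i j] .
  moreover have "submatrix ?A I J $$ (i, ?q) = 1"
    using entries[OF one(1) q] one(2) by simp
  moreover have "?A $$ (pick I i, pick J ?q) = (if pick J ?q < ?q then 1 else 0)"
    using pick_le[OF i] pick_le[OF j] by (simp add: filled_columns_def)
  ultimately have "pick J ?q < ?q" by presburger
  moreover have "pick J m \<ge> m" if "m \<le> ?q" for m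
    using that
  proof (induction m)
    case (Suc m)
    have "pick J m < pick J (Suc m)"
    proof (cases "finite J")
      case True
      then have "card {j. j < dim_col ?A \<and> j \<in> J} \<le> card J"
        by (intro card_mono) auto
      then have "Suc m < card J" using j Suc.prems by linarith
      then show ?thesis by (rule pick_mono_le) simp
    qed (rule pick_mono_inf, assumption, rule lessI)
    then show ?case using Suc by simp
  qed simp
  ultimately show False by (meson leD order_refl)
qed

lemma filled_columns_candidate:
  assumes "i < dim_row P" "P $$ (i, dim_col P - 1) = 1" "dim_col P \<ge> 1"
  shows "num_ones (filled_columns n (dim_col P - 1))
    \<in> {num_ones A | A. A \<in> carrier_mat n n \<and> zero_one_mat A \<and> avoids_mat A P}"
  using filled_columns_avoid[OF assms, of n] zero_one_mat_filled_columns[of n "dim_col P - 1"]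
  by (intro CollectI exI[of _ "filled_columns n (dim_col P - 1)"]) (simp add: filled_columns_def)

lemma ex_ge_filled_columns:
  assumes "i < dim_row P" "P $$ (i, dim_col P - 1) = 1" "dim_col P \<ge> 1"
  shows "n * min n (dim_col P - 1) \<le> ex n P"
  using Max_ge[OF finite_ex_candidates filled_columns_candidate[OF assms]]
  by (simp add: ex_def num_ones_filled_columns)

text \<open>
  The maximum is taken over a nonempty set as soon as \<open>P\<close> has a one in its last column, by the
  avoiding matrices used for the lower bound.
\<close>

lemma ex_attained:
  assumes "i < dim_row P" "P $$ (i, dim_col P - 1) = 1" "dim_col P \<ge> 1"
  obtains A where "A \<in> carrier_mat n n" "avoids_mat A P" "num_ones A = ex n P"
proof -
  let ?S = "{num_ones A | A. A \<in> carrier_mat n n \<and> zero_one_mat A \<and> avoids_mat A P}"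
  have "Max ?S \<in> ?S"
    using filled_columns_candidate[OF assms, of n] by (intro Max_in finite_ex_candidates) blast
  then show ?thesis using that unfolding ex_def by auto
qed

section \<open>An upper bound from shared sets of rows\<close>

lemma contains_mat_if_all_ones_block:
  assumes P: "zero_one_mat P"
    and I: "I \<subseteq> {..<dim_row A}" "dim_row P \<le> card I"
    and J: "J \<subseteq> {..<dim_col A}" "dim_col P \<le> card J"
    and ones: "\<And>i j. i \<in> I \<Longrightarrow> j \<in> J \<Longrightarrow> A $$ (i, j) = 1"
  shows "contains_mat A P"
proof -
  obtain I' where I': "I' \<subseteq> I" "card I' = dim_row P"
    using I(2) by (meson obtain_subset_with_card_n)
  obtain J' where J': "J' \<subseteq> J" "card J' = dim_col P"
    using J(2) by (meson obtain_subset_with_card_n)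
  have rows: "{i. i < dim_row A \<and> i \<in> I'} = I'" and cols: "{j. j < dim_col A \<and> j \<in> J'} = J'"
    using I(1) I'(1) J(1) J'(1) by auto
  have one: "submatrix A I' J' $$ (i, j) = 1" if "i < dim_row P" "j < dim_col P" for i j
  proof -
    have "pick I' i \<in> I'" "pick J' j \<in> J'"
      using that I'(2) J'(2) by (simp_all add: pick_in_set_le)
    then have "A $$ (pick I' i, pick J' j) = 1"
      using ones I'(1) J'(1) by blast
    then show ?thesis
      using that I'(2) J'(2) by (simp add: submatrix_index rows cols)
  qed
  show ?thesis
    unfolding contains_mat_def
  proof (rule exI[of _ I'], rule exI[of _ J'], intro conjI allI impI)
    show "submatrix A I' J' $$ (i, j) = P $$ (i, j) \<or>
        submatrix A I' J' $$ (i, j) = 1 \<and> P $$ (i, j) = 0"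
      if "i < dim_row P" "j < dim_col P" for i j
      using zero_one_mat_entry[OF P that] one[OF that] by auto
  qed (simp_all add: dim_submatrix rows cols I'(2) J'(2))
qed

text \<open>
  Double counting of the pairs of an \<open>r\<close>-subset \<open>I\<close> and an index \<open>j\<close> with \<open>I \<subseteq> N j\<close>: each of the
  indices has at least \<open>k choose r\<close> such subsets, so on average, and hence for some \<open>I\<close>, more than
  \<open>t\<close> indices share the same one.
\<close>

lemma popular_subset:
  fixes N :: "'c \<Rightarrow> 'r set"
  assumes fin: "finite H" "finite X"
    and sub: "\<And>j. j \<in> H \<Longrightarrow> N j \<subseteq> X"
    and big: "\<And>j. j \<in> H \<Longrightarrow> k \<le> card (N j)"
    and less: "t * (card X choose r) < card H * (k choose r)"
  shows "\<exists>I\<subseteq>X. card I = r \<and> t < card {j \<in> H. I \<subseteq> N j}"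
proof (rule ccontr)
  assume "\<not> ?thesis"
  then have few: "card {j \<in> H. I \<subseteq> N j} \<le> t" if "I \<subseteq> X" "card I = r" for I
    using that by (auto simp: not_less)
  let ?R = "{I. I \<subseteq> X \<and> card I = r}"
  have finR: "finite ?R" using fin(2) by simp
  have "card H * (k choose r) = (\<Sum>j\<in>H. k choose r)" by simp
  also have "\<dots> \<le> (\<Sum>j\<in>H. card {I \<in> ?R. I \<subseteq> N j})"
  proof (rule sum_mono)
    fix j assume j: "j \<in> H"
    have "{I \<in> ?R. I \<subseteq> N j} = {I. I \<subseteq> N j \<and> card I = r}"
      using sub[OF j] by auto
    then have "card {I \<in> ?R. I \<subseteq> N j} = card (N j) choose r"
      using n_subsets[OF finite_subset[OF sub[OF j] fin(2)]] by simp
    then show "k choose r \<le> card {I \<in> ?R. I \<subseteq> N j}"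
      using binomial_right_mono[OF big[OF j]] by simp
  qed
  also have "\<dots> = (\<Sum>I\<in>?R. card {j \<in> H. I \<subseteq> N j})"
    by (intro sum_multicount_gen fin(1) finR) simp
  also have "\<dots> \<le> (\<Sum>I\<in>?R. t)"
    using few by (intro sum_mono) blast
  also have "\<dots> = t * (card X choose r)"
    using n_subsets[OF fin(2)] by simp
  finally show False using less by simp
qed

text \<open>
  Columns with fewer than \<open>k\<close> ones account for at most \<open>n * k\<close> of the ones, and the \<open>n * k\<close> that
  remain cannot fit into fewer than \<open>k\<close> columns.
\<close>

lemma many_columns_with_many_ones:
  assumes A: "A \<in> carrier_mat n n" and n: "n \<ge> 1" and ones: "2 * (n * k) \<le> num_ones A"
  shows "k \<le> card {j. j < n \<and> k \<le> card {i. i < n \<and> A $$ (i, j) = 1}}"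
proof -
  let ?c = "\<lambda>j. card {i. i < n \<and> A $$ (i, j) = 1}"
  let ?H = "{j. j < n \<and> k \<le> ?c j}"
  have c_le: "?c j \<le> n" for j
    using card_mono[of "{..<n}" "{i. i < n \<and> A $$ (i, j) = 1}"] by auto
  have "num_ones A = (\<Sum>j<n. ?c j)"
    using A num_ones_by_columns[of A] by simp
  also have "\<dots> \<le> (\<Sum>j<n. k + (if j \<in> ?H then n else 0))"
    using c_le by (intro sum_mono) (auto intro: trans_le_add2)
  also have "\<dots> = n * k + card ?H * n"
  proof -
    have "(\<Sum>j<n. if j \<in> ?H then n else 0) = (\<Sum>j\<in>{..<n} \<inter> ?H. n)"
      by (rule sum.inter_restrict[symmetric]) simp
    moreover have "{..<n} \<inter> ?H = ?H" by auto
    ultimately show ?thesis by (simp add: sum.distrib)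
  qed
  finally have "n * k \<le> card ?H * n" using ones by linarith
  then have "n * k \<le> n * card ?H" by (simp only: mult.commute)
  then show ?thesis using n by (simp only: mult_le_cancel1)
qed

text \<open>
  The bound of Kovari, Sos and Turan, in a form that needs no convexity of binomial coefficients: it
  uses only the columns with many ones, at the cost of a constant factor.
\<close>

lemma avoiding_imp_width_bound:
  assumes A: "A \<in> carrier_mat n n" and av: "avoids_mat A P" and n: "n \<ge> 1"
    and P: "zero_one_mat P" "dim_row P \<le> r"
    and ones: "2 * (n * k) \<le> num_ones A"
  shows "k * (k choose r) \<le> dim_col P * (n choose r)"
proof (rule ccontr)
  let ?N = "\<lambda>j. {i. i < n \<and> A $$ (i, j) = 1}"
  let ?H = "{j. j < n \<and> k \<le> card (?N j)}"
  assume "\<not> ?thesis"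
  then have "dim_col P * (n choose r) < k * (k choose r)" by simp
  also have "k * (k choose r) \<le> card ?H * (k choose r)"
    using many_columns_with_many_ones[OF A n ones] by simp
  finally have less: "dim_col P * (card {..<n} choose r) < card ?H * (k choose r)" by simp
  have "finite ?H" "?N j \<subseteq> {..<n}" "j \<in> ?H \<Longrightarrow> k \<le> card (?N j)" for j by auto
  then obtain I where I: "I \<subseteq> {..<n}" "card I = r" "dim_col P < card {j \<in> ?H. I \<subseteq> ?N j}"
    using popular_subset[of ?H "{..<n}" ?N k "dim_col P" r] less by auto
  have "contains_mat A P"
    by (rule contains_mat_if_all_ones_block[of P I A "{j \<in> ?H. I \<subseteq> ?N j}"])
      (use A P I in auto)
  then show False using av by simp
qed

text \<open>
  The previous bound is applied with \<open>k = \<lfloor>x / 2\<rfloor>\<close>. As \<open>x\<close> is at least \<open>4 * r\<close>, rounding costs at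
  most a factor 2, and \<open>k \<ge> r\<close>, so that \<open>k choose r\<close> is at least \<open>(k / r) ^ r\<close>; on the other side,
  \<open>n choose r\<close> is at most \<open>n ^ r\<close>.
\<close>

lemma ex_ge_imp_width_ge:
  fixes x :: real
  assumes one: "i < dim_row P" "P $$ (i, dim_col P - 1) = 1" "dim_col P \<ge> 1"
    and P: "zero_one_mat P" "dim_row P \<le> r"
    and n: "n \<ge> 1" and x: "x \<ge> 4 * real r" and big: "real n * x \<le> real (ex n P)"
  shows "x ^ Suc r \<le> 4 * (4 * real r) ^ r * (real (dim_col P) * real n ^ r)"
proof -
  obtain A where A: "A \<in> carrier_mat n n" "avoids_mat A P" "num_ones A = ex n P"
    using ex_attained[OF one] by blast
  define k where "k = nat \<lfloor>x / 2\<rfloor>"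
  have r: "r \<ge> 1" using one(1) P(2) by simp
  then have "x \<ge> 4" using x by (simp add: order_trans[of 4 "4 * real r"])
  have kx: "real k \<le> x / 2" "x / 4 \<le> real k"
    using \<open>x \<ge> 4\<close> unfolding k_def by linarith+
  have kr: "r \<le> k" using kx(2) x by simp
  have "real n * (2 * real k) \<le> real n * x"
    using kx(1) by (intro mult_left_mono) auto
  then have "real (2 * (n * k)) \<le> real (num_ones A)" using big A(3) by simp
  then have "2 * (n * k) \<le> num_ones A" by (simp only: of_nat_le_iff)
  from avoiding_imp_width_bound[OF A(1,2) n P this]
  have "real (k * (k choose r)) \<le> real (dim_col P * (n choose r))" by (simp only: of_nat_le_iff)
  then have kst: "real k * real (k choose r) \<le> real (dim_col P) * real (n choose r)" by simp
  have "n choose r \<le> n ^ r"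
    by (cases "r \<le> n") (simp_all add: binomial_le_pow binomial_eq_0)
  then have nr: "real (n choose r) \<le> real n ^ r" by (metis of_nat_le_iff of_nat_power)
  have "x ^ Suc r = 4 * (4 * real r) ^ r * (x / 4 * (x / 4 / real r) ^ r)"
    using r by (simp add: power_divide power_mult_distrib)
  also have "\<dots> \<le> 4 * (4 * real r) ^ r * (real k * (real k / real r) ^ r)"
    using kx(2) \<open>x \<ge> 4\<close> by (intro mult_left_mono mult_mono power_mono divide_right_mono) auto
  also have "\<dots> \<le> 4 * (4 * real r) ^ r * (real k * real (k choose r))"
    using binomial_ge_n_over_k_pow_k[OF kr, where 'a = real] by (intro mult_left_mono) auto
  also have "\<dots> \<le> 4 * (4 * real r) ^ r * (real (dim_col P) * real n ^ r)"
    using order_trans[OF kst mult_left_mono[OF nr]] by (intro mult_left_mono) auto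
  finally show ?thesis .
qed

section \<open>Asymptotics\<close>

lemma eventually_powr_ge:
  fixes a c :: real
  assumes "a > 0"
  shows "\<forall>\<^sub>F n in sequentially. c \<le> real n powr a"
proof -
  have "filterlim (\<lambda>n. real n powr a) at_top sequentially"
    using assms by real_asymp
  then show ?thesis by (simp add: filterlim_at_top)
qed

theorem corollary3p5:
  fixes r :: nat and s :: "nat \<Rightarrow> nat" and P :: "nat \<Rightarrow> nat mat"
  assumes "r \<ge> 1"
    and "\<And>n. n \<ge> 1 \<Longrightarrow> s n \<ge> 1"
    and "\<And>n. n \<ge> 1 \<Longrightarrow> zero_one_mat (P (s n))"
    and "\<And>n. n \<ge> 1 \<Longrightarrow> dim_col (P (s n)) = s n"
    and "\<And>n. n \<ge> 1 \<Longrightarrow> dim_row (P (s n)) \<le> r"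
    and "\<And>n. n \<ge> 1 \<Longrightarrow> ones_in_first_and_last_column (P (s n))"
  shows "Omega_pow_minus_o1 2 (\<lambda>n. ex n (P (s n))) \<longleftrightarrow> Omega_pow_minus_o1 1 s"
proof
  assume ex_large: "Omega_pow_minus_o1 2 (\<lambda>n. ex n (P (s n)))"
  show "Omega_pow_minus_o1 1 s"
    unfolding Omega_pow_minus_o1_def
  proof (intro allI impI)
    fix \<epsilon> :: real assume "\<epsilon> > 0"
    \<comment> \<open>The loss in the exponent is \<open>(r + 1) * \<delta>\<close>, at most half of \<open>\<epsilon>\<close>; the other half absorbs the
      constant. The bound \<open>\<delta> \<le> 1 / 2\<close> makes \<open>n powr (1 - \<delta>)\<close> tend to infinity.\<close>
    define \<delta> where "\<delta> = min (1 / 2) (\<epsilon> / (2 * real (Suc r)))"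
    have \<delta>: "\<delta> > 0" "1 - \<delta> > 0" "real (Suc r) * \<delta> \<le> \<epsilon> / 2"
    proof -
      show "\<delta> > 0" "1 - \<delta> > 0" using \<open>\<epsilon> > 0\<close> unfolding \<delta>_def by auto
      have "real (Suc r) * \<delta> \<le> real (Suc r) * (\<epsilon> / (2 * real (Suc r)))"
        unfolding \<delta>_def by (intro mult_left_mono) auto
      then show "real (Suc r) * \<delta> \<le> \<epsilon> / 2" by (simp del: of_nat_Suc)
    qed
    define C where "C = 4 * (4 * real r) ^ r"
    have C: "C > 0" using \<open>r \<ge> 1\<close> unfolding C_def by simp
    have "\<forall>\<^sub>F n in sequentially. real (ex n (P (s n))) \<ge> real n powr (2 - \<delta>)"
      using ex_large \<delta>(1) unfolding Omega_pow_minus_o1_def by blast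
    moreover have "\<forall>\<^sub>F n in sequentially. 4 * real r \<le> real n powr (1 - \<delta>)"
      using \<delta>(2) by (rule eventually_powr_ge)
    moreover have "\<forall>\<^sub>F n in sequentially. C \<le> real n powr (\<epsilon> / 2)"
      using \<open>\<epsilon> > 0\<close> by (intro eventually_powr_ge) simp
    ultimately show "\<forall>\<^sub>F n in sequentially. real n powr (1 - \<epsilon>) \<le> real (s n)"
      using eventually_ge_at_top[of 1]
    proof eventually_elim
      case (elim n)
      have n: "real n > 0" using elim(4) by simp
      obtain i where i: "i < dim_row (P (s n))" "P (s n) $$ (i, dim_col (P (s n)) - 1) = 1"
        using assms(6)[OF elim(4)] unfolding ones_in_first_and_last_column_def by blast
      have "real n powr (2 - \<delta>) = real n powr (1 + (1 - \<delta>))" by simp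
      also have "\<dots> = real n * real n powr (1 - \<delta>)"
        using n by (simp only: powr_add) simp
      finally have "real n * real n powr (1 - \<delta>) \<le> real (ex n (P (s n)))"
        using elim(1) by simp
      then have main: "(real n powr (1 - \<delta>)) ^ Suc r \<le> C * (real (s n) * real n ^ r)"
        using ex_ge_imp_width_ge[OF i _ assms(3,5) elim(4) elim(2)] elim(4)
          assms(2,4)[OF elim(4)] unfolding C_def by simp
      have "C * (real n powr (1 - \<epsilon>) * real n ^ r)
          \<le> real n powr (\<epsilon> / 2) * (real n powr (1 - \<epsilon>) * real n powr real r)"
        using elim(3) n by (simp add: powr_realpow)
      also have "\<dots> = real n powr (\<epsilon> / 2 + (1 - \<epsilon> + real r))"
        by (simp only: powr_add)
      also have "\<dots> \<le> real n powr ((1 - \<delta>) * real (Suc r))"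
        using elim(4) \<delta>(3) by (intro powr_mono) (auto simp: algebra_simps)
      also have "\<dots> = (real n powr (1 - \<delta>)) ^ Suc r"
        using n by (simp only: powr_powr[symmetric] powr_realpow powr_gt_zero)
      also note main
      finally show ?case using C n by simp
    qed
  qed
next
  assume s_large: "Omega_pow_minus_o1 1 s"
  show "Omega_pow_minus_o1 2 (\<lambda>n. ex n (P (s n)))"
    unfolding Omega_pow_minus_o1_def
  proof (intro allI impI)
    fix \<epsilon> :: real assume "\<epsilon> > 0"
    \<comment> \<open>One half of \<open>\<epsilon>\<close> is lost in the exponent; the other absorbs the factor 2 from
      \<open>s n - 1 \<ge> n powr (1 - \<delta>) / 2\<close>.\<close>
    define \<delta> where "\<delta> = min (1 / 2) (\<epsilon> / 2)"
    have \<delta>: "\<delta> > 0" "1 - \<delta> > 0" "\<delta> \<le> \<epsilon> / 2"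
      using \<open>\<epsilon> > 0\<close> unfolding \<delta>_def by auto
    have "\<forall>\<^sub>F n in sequentially. real (s n) \<ge> real n powr (1 - \<delta>)"
      using s_large \<delta>(1) unfolding Omega_pow_minus_o1_def by blast
    moreover have "\<forall>\<^sub>F n in sequentially. 2 \<le> real n powr (1 - \<delta>)"
      using \<delta>(2) by (rule eventually_powr_ge)
    moreover have "\<forall>\<^sub>F n in sequentially. 2 \<le> real n powr (\<epsilon> / 2)"
      using \<open>\<epsilon> > 0\<close> by (intro eventually_powr_ge) simp
    ultimately show "\<forall>\<^sub>F n in sequentially. real n powr (2 - \<epsilon>) \<le> real (ex n (P (s n)))"
      using eventually_ge_at_top[of 1]
    proof eventually_elim
      case (elim n)
      have n: "real n > 0" using elim(4) by simp
      obtain i where i: "i < dim_row (P (s n))" "P (s n) $$ (i, dim_col (P (s n)) - 1) = 1"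
        using assms(6)[OF elim(4)] unfolding ones_in_first_and_last_column_def by blast
      have "real n powr (1 - \<delta>) \<le> real n powr 1"
        using elim(4) \<delta>(1) by (intro powr_mono) auto
      then have "real n powr (1 - \<delta>) \<le> real n" using n by simp
      then have half: "real n powr (1 - \<delta>) / 2 \<le> real (min n (s n - 1))"
        using elim(1,2) by (auto simp: min_def of_nat_diff)
      have "real n powr (2 - \<epsilon>) * 2 \<le> real n powr (2 - \<epsilon>) * real n powr (\<epsilon> / 2)"
        using elim(3) by (intro mult_left_mono) auto
      also have "\<dots> = real n powr (2 - \<epsilon> / 2)"
        by (simp flip: powr_add)
      also have "\<dots> \<le> real n powr (1 + (1 - \<delta>))"
        using elim(4) \<delta>(3) by (intro powr_mono) auto
      also have "\<dots> = real n * real n powr (1 - \<delta>)"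
        using n by (simp only: powr_add) simp
      finally have "real n powr (2 - \<epsilon>) \<le> real n * (real n powr (1 - \<delta>) / 2)" by simp
      also have "\<dots> \<le> real n * real (min n (s n - 1))"
        using half by (intro mult_left_mono) auto
      also have "\<dots> = real (n * min n (s n - 1))" by simp
      also have "\<dots> \<le> real (ex n (P (s n)))"
        using ex_ge_filled_columns[OF i, of n] assms(2,4)[OF elim(4)] by (simp only: of_nat_le_iff)
      finally show ?case .
    qed
  qed
qed

end
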